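(* Let $q$ be a prime power, $k\ge1$, $n=2k+1$, and let $\alpha$ be a primitive element of $\mathbb{F}_{q^n}$ (with $\mathbb{F}_{q^n}$ identified with $\mathbb{F}_q^n$ as an $\mathbb{F}_q$-vector space). Suppose there is a sequence $X_1,Y_1,X_2,Y_2,\ldots,X_t,Y_t$ of subspaces of $\mathbb{F}_q^{n}$ such that: (P.1) each $X_i$ ($1\le i\le t$) has dimension $k$; (P.2) each $Y_i$ ($1\le i\le t$) has dimension $k+1$; (P.3) the $2t$ subspaces of the sequence lie in $2t$ pairwise different equivalence classes of the relations $E_k$ and $E_{k+1}$; (P.4) $X_i\subset Y_i$ for $1\le i\le t$; (P.5) $X_{i+1}\subset Y_i$ for $1\le i\le t-1$; (P.6) there is an integer $\ell$ with $\alpha^\ell X_1\subset Y_t$ and $\gcd\!\left(\ell,\frac{q^{2k+1}-1}{q-1}\right)=1$. Then the middle levels graph of $\mathcal{P}_q(2k+1)$ contains a cycle of length $2t\cdot\frac{q^{2k+1}-1}{q-1}$.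
   Context: $\mathcal{P}_q(n)$ is the graph on all subspaces of $\mathbb{F}_q^n$ where $X,Y$ are adjacent iff one contains the other and their dimensions differ by one. The middle levels graph of $\mathcal{P}_q(2k+1)$ is the subgraph induced by the $k$- and $(k+1)$-dimensional subspaces. For a subspace $X$ and nonzero $\beta\in\mathbb{F}_{q^n}$, $\beta X=\{\beta x: x\in X\}$ (again a subspace of the same dimension). For $0\le r\le n$, $E_r$ is the relation on the set of $r$-dimensional subspaces of $\mathbb{F}_q^n$ given by $(X,Y)\in E_r$ iff $Y=\alpha^jX$ for some integer $j$; it is an equivalence relation. *)

theory Defs
  imports "HOL-Analysis.Cartesian_Space" "Graph_Theory.Graph_Theory"
begin

text \<open>
  Throughout, the type \<open>'f\<close> is the field with \<open>q = CARD('f)\<close> elements,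
  \<open>'f ^ 'n\<close> is its \<open>n\<close>-dimensional coordinate space with \<open>n = CARD('n)\<close>, and
  \<open>'a\<close> is the extension field with \<open>q ^ n\<close> elements.
\<close>

text \<open>
  The field \<open>'a\<close> is a vector space over \<open>'f\<close> by way of \<open>\<iota> :: 'f \<Rightarrow> 'a\<close>, and \<open>\<phi>\<close> is an
  \<open>'f\<close>-linear isomorphism onto \<open>'f ^ 'n\<close>. The vector space axioms contained in
  \<open>Vector_Spaces.linear\<close> say precisely that \<open>\<iota>\<close> is a homomorphism of fields, and
  \<open>CARD('a) = CARD('f) ^ CARD('n)\<close> follows from \<open>bij \<phi>\<close>.
\<close>

definition identification ::
    "('f::{field,finite} \<Rightarrow> 'a::{field,finite}) \<Rightarrow> ('a \<Rightarrow> 'f ^ 'n::finite) \<Rightarrow> bool" where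
  "identification \<iota> \<phi> \<longleftrightarrow> Vector_Spaces.linear (\<lambda>c x. \<iota> c * x) (*s) \<phi> \<and> bij \<phi>"

definition primitive_element :: "'a::{field,finite} \<Rightarrow> bool" where
  "primitive_element \<alpha> \<longleftrightarrow> range (\<lambda>i::nat. \<alpha> ^ i) = UNIV - {0}"

definition subspaces_of_dim :: "nat \<Rightarrow> ('f::field ^ 'n::finite) set set" where
  "subspaces_of_dim r = {X. vec.subspace X \<and> vec.dim X = r}"

text \<open>The subspace \<open>\<beta>X\<close>, with the product formed in \<open>'a\<close> through the identification \<open>\<phi>\<close>.\<close>

definition field_mult ::
    "('a::{field,finite} \<Rightarrow> 'f::{field,finite} ^ 'n::finite) \<Rightarrow> 'a \<Rightarrow> ('f ^ 'n) set \<Rightarrow> ('f ^ 'n) set" where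
  "field_mult \<phi> \<beta> X = (\<lambda>x. \<phi> (\<beta> * inv \<phi> x)) ` X"

definition orbit_rel ::
    "('a::{field,finite} \<Rightarrow> 'f::{field,finite} ^ 'n::finite) \<Rightarrow> 'a \<Rightarrow> nat \<Rightarrow> ('f ^ 'n) set rel" where
  "orbit_rel \<phi> \<alpha> r = {(X, Y). X \<in> subspaces_of_dim r \<and> Y \<in> subspaces_of_dim r \<and>
     (\<exists>j::int. Y = field_mult \<phi> (\<alpha> powi j) X)}"

text \<open>Undirected graphs are represented as symmetric digraphs.\<close>

definition subspace_graph :: "('f::field ^ 'n::finite) set pair_pre_digraph" where
  "subspace_graph = \<lparr> pverts = {X. vec.subspace X},
     parcs = {(X, Y). vec.subspace X \<and> vec.subspace Y \<and> (X \<subseteq> Y \<or> Y \<subseteq> X) \<and>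
       (vec.dim Y = vec.dim X + 1 \<or> vec.dim X = vec.dim Y + 1)} \<rparr>"

definition middle_levels_graph ::
    "nat \<Rightarrow> (('f::field ^ 'n::finite) set, ('f ^ 'n) set \<times> ('f ^ 'n) set) pre_digraph" where
  "middle_levels_graph k =
     with_proj subspace_graph \<restriction> (subspaces_of_dim k \<union> subspaces_of_dim (k + 1))"

text \<open>
  \<open>pre_digraph.cycle\<close> also admits an edge traversed back and forth; the bound \<open>3 \<le> m\<close>
  leaves exactly the cycles of the underlying simple graph.
\<close>

definition has_cycle_of_length :: "('v, 'e) pre_digraph \<Rightarrow> nat \<Rightarrow> bool" where
  "has_cycle_of_length G m \<longleftrightarrow> 3 \<le> m \<and> (\<exists>p. pre_digraph.cycle G p \<and> length p = m)"

end

theory Submission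
  imports Defs "HOL-Computational_Algebra.Polynomial"
begin

text \<open>
  Put \<open>N = (q\<^sup>n - 1) / (q - 1)\<close>. If \<open>b\<close> stabilizes an \<open>r\<close>-dimensional subspace, then multiplication
  by \<open>b\<close> permutes its \<open>q\<^sup>r - 1\<close> nonzero vectors, so \<open>b ^ (q\<^sup>r) = b\<close> as in Fermat's little theorem;
  together with \<open>b ^ (q\<^sup>n) = b\<close> and \<open>gcd r n = 1\<close> this gives \<open>b ^ q = b\<close>, i.e. \<open>b\<close> lies in the base
  field. Both \<open>k\<close> and \<open>k + 1\<close> are coprime to \<open>n = 2k + 1\<close>, so on the two middle levels \<open>\<alpha>\<^sup>j\<close> fixes a
  subspace iff \<open>N\<close> divides \<open>j\<close>. Hence following the given sequence, its image under \<open>\<alpha>\<^sup>l\<close>, its image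
  under \<open>\<alpha> ^ (2l)\<close>, and so on, the walk closes up after exactly \<open>N\<close> rounds, and since \<open>l\<close> is
  coprime to \<open>N\<close> it repeats no vertex before that.
\<close>

section \<open>Cardinality of subspaces and power identities in finite fields\<close>

lemma card_subspace:
  fixes S :: "('f::{field,finite} ^ 'n::finite) set"
  assumes "vec.subspace S"
  shows "card S = CARD('f) ^ vec.dim S"
proof -
  have span: "card (vec.span B) = CARD('f) ^ card B"
    if "finite B" "vec.independent B" for B :: "('f ^ 'n) set"
    using that
  proof (induction B rule: finite_induct)
    case (insert a B)
    have a: "a \<notin> vec.span B" and B: "vec.independent B"
      using insert.prems insert.hyps by (auto simp: vec.independent_insert split: if_splits)
    \<comment> \<open>Adjoining \<open>a\<close> multiplies the size of the span by
      \<open>CARD('f)\<close>: a vector of the new span determines both its coefficient at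
      \<open>a\<close> and its remainder in the span of \<open>B\<close>.\<close>
    let ?f = "\<lambda>(c, x). c *s a + x"
    have "vec.span (insert a B) = ?f ` (UNIV \<times> vec.span B)"
    proof (intro set_eqI iffI)
      fix x assume "x \<in> vec.span (insert a B)"
      then obtain c where "x - c *s a \<in> vec.span B"
        by (auto simp: vec.span_breakdown_eq)
      then show "x \<in> ?f ` (UNIV \<times> vec.span B)"
        by (intro image_eqI[of _ _ "(c, x - c *s a)"]) auto
    next
      fix x assume "x \<in> ?f ` (UNIV \<times> vec.span B)"
      then obtain c y where "x = c *s a + y" "y \<in> vec.span B"
        by auto
      then show "x \<in> vec.span (insert a B)"
        unfolding vec.span_breakdown_eq by (intro exI[of _ c]) simp
    qed
    moreover have "inj_on ?f (UNIV \<times> vec.span B)"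
    proof (rule inj_onI, clarify)
      fix c x d y
      assume x: "x \<in> vec.span B" and y: "y \<in> vec.span B" and eq: "c *s a + x = d *s a + y"
      have "(c - d) *s a = y - x"
        using eq by (simp add: vec.scale_left_diff_distrib algebra_simps)
      then have "(c - d) *s a \<in> vec.span B"
        using x y by (simp add: vec.span_diff)
      \<comment> \<open>Otherwise dividing by \<open>c - d\<close> would put \<open>a\<close> into
        the span of \<open>B\<close>.\<close>
      then have "c = d"
        using a vec.span_scale[of "(c - d) *s a" B "inverse (c - d)"] by (cases "c = d") auto
      with eq show "c = d \<and> x = y"
        by simp
    qed
    ultimately have "card (vec.span (insert a B)) = CARD('f) * card (vec.span B)"
      by (simp add: card_image card_cartesian_product)
    then show ?case
      using insert B by simp
  qed simp
  obtain B where "B \<subseteq> S" "vec.independent B" "S \<subseteq> vec.span B" "card B = vec.dim S"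
    using vec.basis_exists[of S] by blast
  moreover from this have "vec.span B = S"
    using assms vec.span_minimal by blast
  ultimately show ?thesis
    using span[of B] by (metis vec.finiteI_independent)
qed

text \<open>Multiplication by \<open>b\<close> permutes the nonzero elements of \<open>S\<close>.
  Their product is therefore unchanged when each factor is multiplied by \<open>b\<close>, and being
  nonzero it can be cancelled.\<close>

lemma power_card_eq_1_of_mult_invariant:
  fixes b :: "'a::field"
  assumes "finite S" "b \<noteq> 0" "(*) b ` S = S"
  shows "b ^ card (S - {0}) = 1"
proof -
  have "(*) b ` (S - {0}) = S - {0}"
    using assms(2,3) by (subst image_set_diff) (auto simp: inj_on_def)
  then have "(\<Prod>x\<in>S - {0}. x) = (\<Prod>x\<in>S - {0}. b * x)"
    using assms(2) prod.reindex[of "(*) b" "S - {0}" "\<lambda>x. x"] by (simp add: inj_on_def)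
  also have "\<dots> = b ^ card (S - {0}) * (\<Prod>x\<in>S - {0}. x)"
    by (simp add: prod.distrib)
  finally show ?thesis
    using assms(1) by simp
qed

lemma power_card_minus_1_field:
  fixes b :: "'a::{field,finite}"
  assumes "b \<noteq> 0"
  shows "b ^ (CARD('a) - 1) = 1"
proof -
  have "(*) b ` UNIV = UNIV"
    using assms by (auto intro!: image_eqI[of _ _ "_ / b"])
  then have "b ^ card (UNIV - {0::'a}) = 1"
    using assms by (intro power_card_eq_1_of_mult_invariant) auto
  then show ?thesis
    by (simp add: card_Diff_singleton)
qed

lemma power_card_field:
  fixes b :: "'a::{field,finite}"
  shows "b ^ CARD('a) = b"
proof (cases "b = 0")
  case False
  then show ?thesis
    using power_minus_mult[of "CARD('a)" b] power_card_minus_1_field[OF False] by simp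
qed simp

lemma minus_1_dvd_power_minus_1: "q - 1 dvd q ^ m - 1" for q :: nat
proof (cases "q = 0")
  case False
  then have "int (q - 1) dvd int (q ^ m - 1)"
    by (simp add: power_diff_1_eq of_nat_diff)
  then show ?thesis
    by (simp only: int_dvd_int_iff)
\<comment> \<open>For \<open>q = 0\<close> truncated subtraction makes both sides 0.\<close>
qed (cases m; simp)

lemma power_mod_exponent:
  fixes x :: "'a::monoid_mult"
  assumes "x ^ m = 1"
  shows "x ^ (i mod m) = x ^ i"
proof -
  have "x ^ i = x ^ (m * (i div m) + i mod m)"
    by simp
  also have "\<dots> = x ^ (i mod m)"
    by (simp only: power_add power_mult assms power_one mult_1_left)
  finally show ?thesis by simp
qed

lemma power_pow_iterate:
  fixes x :: "'a::monoid_mult"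
  assumes "x ^ m = x"
  shows "x ^ (m ^ i) = x"
  by (induction i) (simp_all add: assms power_mult)

text \<open>The hypotheses say that \<open>x\<close> is fixed by the \<open>r\<close>-fold and the
  \<open>n\<close>-fold iterate of raising to the power \<open>q\<close>. By Bezout, some multiple
  of \<open>r\<close> exceeds a multiple of \<open>n\<close> by one, which leaves a single
  application.\<close>

lemma power_eq_self_of_coprime_exponents:
  fixes x :: "'a::monoid_mult"
  assumes "x ^ (q ^ r) = x" "x ^ (q ^ n) = x" "coprime r n" "r \<noteq> 0"
  shows "x ^ q = x"
proof -
  obtain a b where ab: "r * a = n * b + 1"
    using bezout_nat[of r n] assms(3,4) by auto
  have "x = x ^ (q ^ (r * a))"
    using power_pow_iterate[OF assms(1)] by (simp add: power_mult)
  also have "q ^ (r * a) = (q ^ n) ^ b * q"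
    unfolding ab by (simp add: power_mult power_add)
  also have "x ^ \<dots> = (x ^ ((q ^ n) ^ b)) ^ q"
    by (rule power_mult)
  also have "x ^ ((q ^ n) ^ b) = x"
    using power_pow_iterate[OF assms(2)] .
  finally show ?thesis by simp
qed

section \<open>The order of a primitive element\<close>

lemma primitive_element_nonzero:
  assumes "primitive_element \<alpha>"
  shows "\<alpha> \<noteq> 0"
proof
  assume "\<alpha> = 0"
  then have "\<alpha> ^ 1 \<notin> range (\<lambda>i::nat. \<alpha> ^ i)"
    using assms by (simp add: primitive_element_def)
  then show False by blast
qed

lemma primitive_element_power_eq_1_imp_dvd:
  fixes \<alpha> :: "'a::{field,finite}"
  assumes "primitive_element \<alpha>" "\<alpha> ^ i = 1"
  shows "CARD('a) - 1 dvd i"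
proof -
  have 0: "\<alpha> \<noteq> 0"
    by (rule primitive_element_nonzero[OF assms(1)])
  have one: "\<alpha> ^ (CARD('a) - 1) = 1"
    by (rule power_card_minus_1_field[OF 0])
  define d where "d = i mod (CARD('a) - 1)"
  have d: "\<alpha> ^ d = 1"
    using power_mod_exponent[OF one, of i] assms(2) unfolding d_def by simp
  have "CARD('a) > 1"
    using card_mono[of UNIV "{0, 1::'a}"] by simp
  then have less: "d < CARD('a) - 1"
    by (simp add: d_def)
  have "d = 0"
  proof (rule ccontr)
    assume "d \<noteq> 0"
    \<comment> \<open>If \<open>\<alpha> ^ d = 1\<close> with \<open>d\<close> positive, the powers
      of \<open>\<alpha>\<close> take at most \<open>d\<close> values, too few to exhaust the
      nonzero elements.\<close>
    have "UNIV - {0} \<subseteq> (\<lambda>i. \<alpha> ^ i) ` {..<d}"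
    proof
      fix x :: 'a assume "x \<in> UNIV - {0}"
      then obtain j where "x = \<alpha> ^ j"
        using assms(1) unfolding primitive_element_def by blast
      moreover have "\<alpha> ^ j = \<alpha> ^ (j mod d)"
        by (rule power_mod_exponent[OF d, symmetric])
      ultimately show "x \<in> (\<lambda>i. \<alpha> ^ i) ` {..<d}"
        using \<open>d \<noteq> 0\<close> by auto
    qed
    then have "card (UNIV - {0::'a}) \<le> d"
      by (metis card_lessThan finite_lessThan surj_card_le)
    with less show False by (simp add: card_Diff_singleton)
  qed
  then show ?thesis
    by (auto simp: d_def)
qed

lemma primitive_element_power_int_eq_1_iff:
  fixes \<alpha> :: "'a::{field,finite}"
  assumes "primitive_element \<alpha>"
  shows "\<alpha> powi j = 1 \<longleftrightarrow> int (CARD('a) - 1) dvd j"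
proof
  assume "\<alpha> powi j = 1"
  \<comment> \<open>A negative exponent is made positive by inverting both sides.\<close>
  then have "\<alpha> ^ nat \<bar>j\<bar> = 1"
    by (cases "j \<ge> 0") (auto simp: power_int_def power_inverse)
  then have "CARD('a) - 1 dvd nat \<bar>j\<bar>"
    by (rule primitive_element_power_eq_1_imp_dvd[OF assms])
  then show "int (CARD('a) - 1) dvd j"
    by (metis dvd_abs_iff int_dvd_int_iff int_nat_eq abs_ge_zero)
next
  assume "int (CARD('a) - 1) dvd j"
  then show "\<alpha> powi j = 1"
    using power_card_minus_1_field[OF primitive_element_nonzero[OF assms]]
    by (auto elim!: dvdE simp: power_int_mult simp del: of_nat_diff)
qed

section \<open>Cycles from closed sequences of vertices\<close>

lemma cycle_of_closed_sequence:
  assumes "\<And>i. i < m \<Longrightarrow> (f i, f (Suc i)) \<in> arcs G" "tail G = fst" "head G = snd"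
    and "f 0 \<in> verts G" "f m = f 0" "inj_on f {..<m}" "m > 0"
  shows "pre_digraph.cycle G (map (\<lambda>i. (f i, f (Suc i))) [0..<m])"
proof -
  interpret pre_digraph G .
  let ?p = "\<lambda>m. map (\<lambda>i. (f i, f (Suc i))) [0..<m]"
  have cas: "cas (f 0) (?p i) (f i)" for i
  proof (induction i)
    case (Suc i)
    then show ?case
      using awalk_verts_conv'[OF Suc]
      by (cases i) (simp_all add: assms(2,3))
  qed simp
  have "tl (awalk_verts (f 0) (?p m)) = map (\<lambda>i. f (Suc i)) [0..<m]"
    using assms(3) by (simp add: awalk_verts_conv'[OF cas])
  moreover have "inj_on (\<lambda>i. f (Suc i)) {..<m}"
  proof (rule inj_onI)
    fix i j assume ij: "i \<in> {..<m}" "j \<in> {..<m}" "f (Suc i) = f (Suc j)"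
    \<comment> \<open>\<open>cycle\<close> demands distinctness of the vertices at positions 1 to
      \<open>m\<close>, while injectivity is given on 0 to \<open>m - 1\<close>; closedness
      identifies position \<open>m\<close> with 0.\<close>
    have wrap: "f (Suc i) = f (if Suc i = m then 0 else Suc i)" for i
      using assms(5) by simp
    have "(if Suc i = m then 0 else Suc i) = (if Suc j = m then 0 else Suc j)"
      using ij wrap[of i] wrap[of j] by (intro inj_onD[OF assms(6)]) auto
    then show "i = j"
      by (auto split: if_splits)
  qed
  ultimately have "distinct (tl (awalk_verts (f 0) (?p m)))"
    by (simp add: distinct_map atLeast0LessThan)
  moreover have "awalk (f 0) (?p m) (f 0)"
    using assms cas[of m] by (auto simp: awalk_def)
  ultimately show ?thesis
    using assms(7) unfolding cycle_def by auto
qed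

text \<open>The cycle alternates \<open>A 0, B 0, A 1, B 1, ...\<close>; the two families of
  inclusions supply the steps up and down. Vertices at positions of different parity differ in
  dimension, so injectivity on each level is enough.\<close>

lemma middle_levels_cycle:
  fixes A B :: "nat \<Rightarrow> ('f::field ^ 'n::finite) set"
  assumes A: "\<And>s. A s \<in> subspaces_of_dim k" and B: "\<And>s. B s \<in> subspaces_of_dim (k + 1)"
    and sub: "\<And>s. A s \<subseteq> B s" "\<And>s. A (Suc s) \<subseteq> B s"
    and inj: "inj_on A {..<m}" "inj_on B {..<m}" and closed: "A m = A 0" and m: "m \<ge> 2"
  shows "has_cycle_of_length (middle_levels_graph k ::
           (('f ^ 'n) set, ('f ^ 'n) set \<times> ('f ^ 'n) set) pre_digraph) (2 * m)"
proof -
  define f where "f i = (if even i then A (i div 2) else B (i div 2))" for i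
  have neq: "A i \<noteq> B j" for i j
  proof
    assume "A i = B j"
    then have "k = k + 1"
      using A[of i] B[of j] unfolding subspaces_of_dim_def mem_Collect_eq by metis
    then show False by simp
  qed
  have "inj_on f {..<2 * m}"
  proof (rule inj_onI)
    fix i j assume ij: "i \<in> {..<2 * m}" "j \<in> {..<2 * m}" "f i = f j"
    have "even i \<longleftrightarrow> even j"
      using ij(3) neq[of "i div 2" "j div 2"] neq[of "j div 2" "i div 2"]
      by (auto simp: f_def split: if_splits)
    moreover from this have "i div 2 = j div 2"
      using ij by (cases "even i")
        (auto simp: f_def intro: inj_onD[OF inj(1)] inj_onD[OF inj(2)])
    ultimately show "i = j"
      by presburger
  qed
  moreover have "(f i, f (Suc i)) \<in> arcs (middle_levels_graph k)" for i
    using A[of "i div 2"] B[of "i div 2"] A[of "Suc (i div 2)"]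
      sub(1)[of "i div 2"] sub(2)[of "i div 2"]
    by (cases "even i")
      (auto simp: f_def middle_levels_graph_def subspace_graph_def subspaces_of_dim_def)
  moreover have "f 0 \<in> verts (middle_levels_graph k)" "f (2 * m) = f 0"
    using A[of 0] closed by (simp_all add: f_def middle_levels_graph_def)
  ultimately have "pre_digraph.cycle (middle_levels_graph k)
      (map (\<lambda>i. (f i, f (Suc i))) [0..<2 * m])"
    using m by (intro cycle_of_closed_sequence) (simp_all add: middle_levels_graph_def)
  then show ?thesis
    using m unfolding has_cycle_of_length_def
    by (intro conjI exI[of _ "map (\<lambda>i. (f i, f (Suc i))) [0..<2 * m]"]) auto
qed

section \<open>Multiplication of subspaces by field elements\<close>

context
  fixes \<iota> :: "'f::{field,finite} \<Rightarrow> 'a::{field,finite}"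
    and \<phi> :: "'a \<Rightarrow> 'f ^ 'n::finite"
  assumes ident: "identification \<iota> \<phi>"
begin

lemma linear_identification: "Vector_Spaces.linear (\<lambda>c x. \<iota> c * x) (*s) \<phi>"
  and bij_identification: "bij \<phi>"
  using ident by (auto simp: identification_def)

lemma inv_identification [simp]: "inv \<phi> (\<phi> x) = x" "\<phi> (inv \<phi> y) = y"
  using bij_identification by (simp_all add: bij_is_inj bij_is_surj surj_f_inv_f)

lemma field_mult_1 [simp]: "field_mult \<phi> 1 S = S"
  by (simp add: field_mult_def)

lemma field_mult_field_mult: "field_mult \<phi> b (field_mult \<phi> c S) = field_mult \<phi> (b * c) S"
  by (simp add: field_mult_def image_image mult.assoc)

lemma field_mult_mono: "S \<subseteq> T \<Longrightarrow> field_mult \<phi> b S \<subseteq> field_mult \<phi> b T"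
  by (auto simp: field_mult_def)

lemma identification_scale: "\<phi> (\<iota> c * x) = c *s \<phi> x"
proof -
  interpret Vector_Spaces.linear "\<lambda>c x. \<iota> c * x" "(*s)" \<phi>
    by (rule linear_identification)
  show ?thesis by (rule scale)
qed

lemma identification_add: "\<phi> (x + y) = \<phi> x + \<phi> y"
proof -
  interpret Vector_Spaces.linear "\<lambda>c x. \<iota> c * x" "(*s)" \<phi>
    by (rule linear_identification)
  show ?thesis by (rule add)
qed

lemma field_mult_in_subspaces_of_dim:
  assumes "b \<noteq> 0" "S \<in> subspaces_of_dim r"
  shows "field_mult \<phi> b S \<in> subspaces_of_dim r"
proof -
  let ?h = "\<lambda>x. \<phi> (b * inv \<phi> x)"
  have inv_add: "inv \<phi> (x + y) = inv \<phi> x + inv \<phi> y" for x y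
    by (metis identification_add inv_identification)
  have inv_scale: "inv \<phi> (c *s x) = \<iota> c * inv \<phi> x" for c x
    by (metis identification_scale inv_identification)
  \<comment> \<open>Multiplication by \<open>b\<close> commutes with the scalars from
    \<open>\<iota>\<close>, so its transport along \<open>\<phi>\<close> is linear; since
    \<open>b\<close> is nonzero it is also injective and preserves dimension.\<close>
  have lin: "Vector_Spaces.linear (*s) (*s) ?h"
    by unfold_locales
      (simp_all add: inv_add inv_scale identification_add ring_distribs
         mult.left_commute[of b] identification_scale)
  have "inj ?h"
    using assms(1) by (intro injI) (metis inv_identification mult_left_cancel)
  then have "vec.dim (?h ` S) = vec.dim S"
    by (intro vec.dim_image_eq[OF lin]) (auto intro: inj_on_subset)
  then show ?thesis
    using assms(2) vec.linear_subspace_image[OF lin]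
    by (auto simp: subspaces_of_dim_def field_mult_def)
qed

lemma card_extension_field: "CARD('a) = CARD('f) ^ CARD('n)"
  using card_subspace[of "UNIV :: ('f ^ 'n) set"] bij_betw_same_card[OF bij_identification]
  by (simp only: vec_dim_card vec.subspace_UNIV)

section \<open>The base field and the stabilizers of subspaces\<close>

lemma power_card_base_eq_self_imp_in_range:
  assumes "b ^ CARD('f) = b"
  shows "b \<in> range \<iota>"
proof -
  interpret v: vector_space "\<lambda>c x. \<iota> c * x"
    using linear_identification by (simp add: Vector_Spaces.linear_def)
  \<comment> \<open>The homomorphism laws of \<open>\<iota>\<close> are the vector space axioms
    evaluated at the vector 1.\<close>
  have mult: "\<iota> (c * d) = \<iota> c * \<iota> d" for c d
    using v.scale_scale[of c d 1] by simp
  have one: "\<iota> 1 = 1"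
    using v.scale_one[of 1] by simp
  have diff: "\<iota> (c - d) = \<iota> c - \<iota> d" for c d
    using v.scale_left_diff_distrib[of c d 1] by simp
  have nz: "\<iota> c \<noteq> 0" if "c \<noteq> 0" for c
    using v.scale_eq_0_iff[of c 1] that by simp
  have inj: "inj \<iota>"
  proof (rule injI)
    fix c d assume "\<iota> c = \<iota> d"
    then show "c = d"
      using nz[of "c - d"] diff[of c d] by auto
  qed
  have q: "CARD('f) > 1"
    using card_mono[of UNIV "{0, 1::'f}"] by simp
  \<comment> \<open>\<open>x\<^sup>q - x\<close> has at most \<open>q\<close> roots, and the \<open>q\<close> elements of \<open>range \<iota>\<close> are roots.\<close>
  let ?p = "monom 1 CARD('f) - monom 1 1 :: 'a poly"
  have deg: "degree ?p \<le> CARD('f)"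
    using q by (intro degree_diff_le) (auto simp: degree_monom_eq)
  have "coeff ?p CARD('f) \<noteq> 0"
    using q by simp
  then have "?p \<noteq> 0"
    by (metis coeff_0)
  have roots: "{x. poly ?p x = 0} = {x. x ^ CARD('f) = x}"
    by (simp add: poly_monom)
  have "card {x::'a. x ^ CARD('f) = x} \<le> CARD('f)"
    using card_poly_roots_bound[OF \<open>?p \<noteq> 0\<close>] deg unfolding roots by linarith
  moreover have "range \<iota> \<subseteq> {x. x ^ CARD('f) = x}"
  proof clarify
    fix c :: 'f
    have "\<iota> (c ^ i) = \<iota> c ^ i" for i
      by (induction i) (simp_all add: one mult)
    then show "\<iota> c ^ CARD('f) = \<iota> c"
      by (metis power_card_field)
  qed
  moreover have "card (range \<iota>) = CARD('f)"
    using inj by (simp add: card_image)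
  ultimately have "range \<iota> = {x. x ^ CARD('f) = x}"
    by (intro card_seteq) auto
  with assms show ?thesis by simp
qed

lemma field_mult_stabilizer:
  assumes S: "S \<in> subspaces_of_dim r" and r: "r \<noteq> 0" "coprime r CARD('n)" and b: "b \<noteq> 0"
  shows "field_mult \<phi> b S = S \<longleftrightarrow> b ^ CARD('f) = b"
proof
  have card_S: "card S = CARD('f) ^ r" and "0 \<in> S"
    using S card_subspace vec.subspace_0 by (auto simp: subspaces_of_dim_def)
  assume stab: "field_mult \<phi> b S = S"
  \<comment> \<open>The product argument needs a subset of the field, so \<open>S\<close> is pulled
    back along \<open>\<phi>\<close>.\<close>
  let ?T = "inv \<phi> ` S"
  have "(*) b ` ?T = inv \<phi> ` field_mult \<phi> b S"
    by (simp add: field_mult_def image_image)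
  then have "(*) b ` ?T = ?T"
    using stab by simp
  then have "b ^ card (?T - {0}) = 1"
    using b by (intro power_card_eq_1_of_mult_invariant) auto
  moreover have "inv \<phi> 0 = 0"
    using identification_add[of 0 0] by (metis add_0 add_cancel_right_right inv_identification(1))
  then have "0 \<in> ?T"
    using \<open>0 \<in> S\<close> by (metis image_eqI)
  moreover have "card ?T = card S"
    by (intro card_image inj_onI) (metis inv_identification(2))
  ultimately have "b ^ (CARD('f) ^ r - 1) = 1"
    using card_S by (simp add: card_Diff_singleton)
  then have "b ^ (CARD('f) ^ r) = b"
    by (metis power_minus_mult mult_1 zero_less_card_finite zero_less_power)
  moreover have "b ^ (CARD('f) ^ CARD('n)) = b"
    using power_card_field[of b] unfolding card_extension_field .
  ultimately show "b ^ CARD('f) = b"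
    using r(2,1) by (rule power_eq_self_of_coprime_exponents)
next
  have sub: "vec.subspace S"
    using S by (simp add: subspaces_of_dim_def)
  assume "b ^ CARD('f) = b"
  then obtain c where c: "b = \<iota> c"
    using power_card_base_eq_self_imp_in_range by blast
  \<comment> \<open>Multiplication by an element of the base field is ordinary scaling, which maps
    \<open>S\<close> into itself; equal cardinality turns the inclusion into equality.\<close>
  have h: "\<phi> (b * inv \<phi> x) = c *s x" for x
    by (simp add: c identification_scale)
  have "card (field_mult \<phi> b S) = card S"
    unfolding field_mult_def using b
    by (intro card_image inj_onI) (metis inv_identification mult_left_cancel)
  moreover have "field_mult \<phi> b S \<subseteq> S"
    using sub by (auto simp: field_mult_def h vec.subspace_scale)
  ultimately show "field_mult \<phi> b S = S"
    by (intro card_subset_eq) auto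
qed

text \<open>For the nonzero element \<open>\<alpha> powi j\<close>, lying in the base field means
  that its power with exponent \<open>q - 1\<close> is 1, where \<open>q = CARD('f)\<close>. As
  \<open>\<alpha>\<close> has order \<open>?N * (q - 1)\<close>, this says that
  \<open>?N * (q - 1)\<close> divides \<open>j * (q - 1)\<close>, and \<open>q - 1\<close>
  cancels.\<close>

lemma field_mult_power_int_stabilizer:
  assumes "S \<in> subspaces_of_dim r" "r \<noteq> 0" "coprime r CARD('n)" "primitive_element \<alpha>"
  shows "field_mult \<phi> (\<alpha> powi j) S = S \<longleftrightarrow>
    int ((CARD('f) ^ CARD('n) - 1) div (CARD('f) - 1)) dvd j" (is "_ \<longleftrightarrow> int ?N dvd j")
proof -
  let ?b = "\<alpha> powi j"
  have b: "?b \<noteq> 0"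
    using primitive_element_nonzero[OF assms(4)] by (simp add: power_int_eq_0_iff)
  have q: "CARD('f) > 1"
    using card_mono[of UNIV "{0, 1::'f}"] by simp
  have "CARD('f) - 1 dvd CARD('f) ^ CARD('n) - 1"
    by (rule minus_1_dvd_power_minus_1)
  then have N: "CARD('a) - 1 = ?N * (CARD('f) - 1)"
    by (simp only: card_extension_field dvd_div_mult_self)
  have "field_mult \<phi> ?b S = S \<longleftrightarrow> ?b ^ CARD('f) = ?b"
    using assms(1-3) b by (rule field_mult_stabilizer)
  also have "\<dots> \<longleftrightarrow> ?b ^ (CARD('f) - 1) = 1"
    using power_minus_mult[of "CARD('f)" ?b] b q by auto
  also have "\<dots> \<longleftrightarrow> \<alpha> powi (j * int (CARD('f) - 1)) = 1"
    by (simp only: power_int_power')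
  also have "\<dots> \<longleftrightarrow> int ?N * int (CARD('f) - 1) dvd j * int (CARD('f) - 1)"
    unfolding primitive_element_power_int_eq_1_iff[OF assms(4)] N by (simp only: of_nat_mult)
  also have "\<dots> \<longleftrightarrow> int ?N dvd j"
    using q by (subst dvd_mult_cancel_right) auto
  finally show ?thesis .
qed

section \<open>Distinctness of the translates along the sequence\<close>

lemma orbit_rel_image_eq:
  assumes "S \<in> subspaces_of_dim r" "T \<in> subspaces_of_dim r" "\<alpha> \<noteq> 0"
    and "T = field_mult \<phi> (\<alpha> powi j) S"
  shows "orbit_rel \<phi> \<alpha> r `` {S} = orbit_rel \<phi> \<alpha> r `` {T}"
proof -
  have "S = field_mult \<phi> (\<alpha> powi (- j)) T"
    using assms(3,4) by (simp add: field_mult_field_mult power_int_minus)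
  then have "field_mult \<phi> (\<alpha> powi i) S = field_mult \<phi> (\<alpha> powi (i - j)) T" for i
    using assms(3) by (metis field_mult_field_mult power_int_add diff_conv_add_uminus)
  moreover have "field_mult \<phi> (\<alpha> powi i) T = field_mult \<phi> (\<alpha> powi (i + j)) S" for i
    using assms(3,4) by (simp add: field_mult_field_mult power_int_add)
  ultimately show ?thesis
    using assms(1,2) by (fastforce simp: orbit_rel_def)
qed

text \<open>The number \<open>s\<close> encodes the round \<open>s div t\<close> and the position
  \<open>s mod t + 1\<close> within it. Equal terms lie in one orbit, so their positions agree. A
  power of \<open>\<alpha>\<close> with exponent \<open>l\<close> times the difference of the rounds
  then stabilizes \<open>Z i\<close>; hence \<open>N\<close> divides that difference, which is
  smaller than \<open>N\<close> in absolute value.\<close>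

lemma inj_on_orbit_sequence:
  fixes t :: nat and l :: int
  defines "N \<equiv> (CARD('f) ^ CARD('n) - 1) div (CARD('f) - 1)"
  assumes Z: "\<And>i. i \<in> {1..t} \<Longrightarrow> Z i \<in> subspaces_of_dim r"
    and orbits: "distinct (map (\<lambda>i. orbit_rel \<phi> \<alpha> r `` {Z i}) [1..<t + 1])"
    and r: "r \<noteq> 0" "coprime r CARD('n)"
    and \<alpha>: "primitive_element \<alpha>" and l: "coprime l (int N)" and t: "t > 0"
  shows "inj_on (\<lambda>s. field_mult \<phi> (\<alpha> powi (l * int (s div t))) (Z (s mod t + 1))) {..<t * N}"
proof (rule inj_onI)
  fix s s'
  assume "s \<in> {..<t * N}" "s' \<in> {..<t * N}"
  then have less: "s div t < N" "s' div t < N"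
    by (auto simp: div_less_iff_less_mult t mult.commute)
  define a i a' i' where "a = s div t" "i = s mod t + 1" "a' = s' div t" "i' = s' mod t + 1"
  note defs = this
  assume "field_mult \<phi> (\<alpha> powi (l * int (s div t))) (Z (s mod t + 1)) =
    field_mult \<phi> (\<alpha> powi (l * int (s' div t))) (Z (s' mod t + 1))"
  then have eq: "field_mult \<phi> (\<alpha> powi (l * int a)) (Z i) = field_mult \<phi> (\<alpha> powi (l * int a')) (Z i')"
    by (simp add: defs)
  have nz: "\<alpha> \<noteq> 0"
    by (rule primitive_element_nonzero[OF \<alpha>])
  have i: "i \<in> {1..t}" "i' \<in> {1..t}"
    using t by (auto simp: defs Suc_le_eq)
  have "field_mult \<phi> (\<alpha> powi (- (l * int a'))) (field_mult \<phi> (\<alpha> powi (l * int a)) (Z i)) = Z i'"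
    unfolding eq using nz by (simp add: field_mult_field_mult power_int_minus)
  then have Zi': "Z i' = field_mult \<phi> (\<alpha> powi (l * (int a - int a'))) (Z i)"
    using nz by (simp add: field_mult_field_mult flip: power_int_add) (simp add: algebra_simps)
  then have "orbit_rel \<phi> \<alpha> r `` {Z i} = orbit_rel \<phi> \<alpha> r `` {Z i'}"
    by (rule orbit_rel_image_eq[OF Z[OF i(1)] Z[OF i(2)] nz])
  moreover have "inj_on (\<lambda>i. orbit_rel \<phi> \<alpha> r `` {Z i}) {1..t}"
    using orbits by (simp add: distinct_map atLeastLessThanSuc_atLeastAtMost del: upt_Suc)
  ultimately have "i = i'"
    using i by (auto dest: inj_onD)
  then have "int N dvd l * (int a - int a')"
    using Zi' field_mult_power_int_stabilizer[OF Z[OF i(1)] r \<alpha>] unfolding N_def by metis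
  then have "int N dvd int a - int a'"
    using l by (metis coprime_commute coprime_dvd_mult_right_iff)
  moreover have "\<bar>int a - int a'\<bar> < int N"
    using less by (auto simp: defs)
  ultimately have "a = a'"
    using zdvd_imp_le[of "int N" "\<bar>int a - int a'\<bar>"] by (cases "a = a'") auto
  with \<open>i = i'\<close> show "s = s'"
    unfolding defs by (metis add_right_cancel div_mult_mod_eq)
qed

end

section \<open>Assembly of the cycle from the given sequence\<close>

theorem theorem1:
  fixes q k t :: nat
    and \<iota> :: "'f::{field,finite} \<Rightarrow> 'a::{field,finite}"
    and \<phi> :: "'a \<Rightarrow> 'f ^ 'n::finite"
    and \<alpha> :: 'a
    and X Y :: "nat \<Rightarrow> ('f ^ 'n) set"
  assumes q: "q = CARD('f)"
    and k: "1 \<le> k"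
    and n: "CARD('n) = 2 * k + 1"
    and ident: "identification \<iota> \<phi>"
    and prim: "primitive_element \<alpha>"
    and t: "1 \<le> t"
    and P1: "\<And>i. i \<in> {1..t} \<Longrightarrow> X i \<in> subspaces_of_dim k"
    and P2: "\<And>i. i \<in> {1..t} \<Longrightarrow> Y i \<in> subspaces_of_dim (k + 1)"
    and P3: "distinct (map (\<lambda>i. orbit_rel \<phi> \<alpha> k `` {X i}) [1..<t + 1] @
                       map (\<lambda>i. orbit_rel \<phi> \<alpha> (k + 1) `` {Y i}) [1..<t + 1])"
    and P4: "\<And>i. i \<in> {1..t} \<Longrightarrow> X i \<subseteq> Y i"
    and P5: "\<And>i. i \<in> {1..t - 1} \<Longrightarrow> X (i + 1) \<subseteq> Y i"
    and P6: "\<exists>l::int. field_mult \<phi> (\<alpha> powi l) (X 1) \<subseteq> Y t \<and>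
                gcd l (int ((q ^ (2 * k + 1) - 1) div (q - 1))) = 1"
  shows "has_cycle_of_length
           (middle_levels_graph k :: (('f ^ 'n) set, ('f ^ 'n) set \<times> ('f ^ 'n) set) pre_digraph)
           (2 * t * ((q ^ (2 * k + 1) - 1) div (q - 1)))"
proof -
  define N where "N = (CARD('f) ^ CARD('n) - 1) div (CARD('f) - 1)"
  have N: "(q ^ (2 * k + 1) - 1) div (q - 1) = N"
    by (simp only: N_def q n)
  obtain l :: int where l: "field_mult \<phi> (\<alpha> powi l) (X 1) \<subseteq> Y t" "gcd l (int N) = 1"
    using P6 unfolding N by (elim exE conjE)
  then have l_coprime: "coprime l (int N)"
    by (simp only: coprime_iff_gcd_eq_1)
  have nz: "\<alpha> \<noteq> 0"
    by (rule primitive_element_nonzero[OF prim])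
  have cop: "coprime k CARD('n)" "coprime (k + 1) CARD('n)"
  proof -
    \<comment> \<open>Both coprimality claims express 1 as a combination:
      \<open>(2 * k + 1) - 2 * k\<close> and \<open>2 * (k + 1) - (2 * k + 1)\<close>.\<close>
    have "d dvd 1" if "d dvd k" "d dvd 2 * k + 1" for d
      using that dvd_add_right_iff[of d "2 * k" 1] by simp
    then show "coprime k CARD('n)"
      unfolding n by (intro coprimeI) auto
    have "d dvd 1" if "d dvd k + 1" "d dvd 2 * k + 1" for d
    proof -
      have "d dvd 2 * (k + 1) - (2 * k + 1)"
        using that by (intro dvd_diff_nat dvd_mult)
      then show ?thesis by simp
    qed
    then show "coprime (k + 1) CARD('n)"
      unfolding n by (intro coprimeI) auto
  qed
  define A B where "A s = field_mult \<phi> (\<alpha> powi (l * int (s div t))) (X (s mod t + 1))"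
    and "B s = field_mult \<phi> (\<alpha> powi (l * int (s div t))) (Y (s mod t + 1))" for s
  have ran: "s mod t + 1 \<in> {1..t}" for s
    using t by (auto simp: Suc_le_eq)
  have "A s \<in> subspaces_of_dim k" "B s \<in> subspaces_of_dim (k + 1)" for s
    using nz P1[OF ran] P2[OF ran] unfolding A_def B_def
    by (auto intro!: field_mult_in_subspaces_of_dim[OF ident])
  moreover have "A s \<subseteq> B s" for s
    unfolding A_def B_def using ran by (intro field_mult_mono[OF ident] P4)
  moreover have "A (Suc s) \<subseteq> B s" for s
  \<comment> \<open>At the end of a round the next vertex is a translate of \<open>X 1\<close> with
    one more factor \<open>\<alpha> powi l\<close>, and \<open>P6\<close> provides the inclusion;
    inside a round it is a translate of \<open>P5\<close>.\<close>
  proof (cases "Suc (s mod t) = t")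
    case True
    then have "A (Suc s) = field_mult \<phi> (\<alpha> powi (l * int (s div t)))
        (field_mult \<phi> (\<alpha> powi l) (X 1))"
      using nz by (simp add: A_def B_def field_mult_field_mult[OF ident] div_Suc mod_Suc distrib_left
          flip: power_int_add) (simp add: add.commute)
    then show ?thesis
      using True l(1) by (simp add: A_def B_def field_mult_mono[OF ident])
  next
    case False
    have "X (Suc (s mod t) + 1) \<subseteq> Y (s mod t + 1)"
      using P5[of "s mod t + 1"] False ran[of s] by auto
    then show ?thesis
      using False by (simp add: A_def B_def div_Suc mod_Suc field_mult_mono[OF ident])
  qed
  moreover have "inj_on A {..<t * N}" "inj_on B {..<t * N}"
  proof -
    have orbits: "distinct (map (\<lambda>i. orbit_rel \<phi> \<alpha> k `` {X i}) [1..<t + 1])"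
      "distinct (map (\<lambda>i. orbit_rel \<phi> \<alpha> (k + 1) `` {Y i}) [1..<t + 1])"
      using P3 unfolding distinct_append by simp_all
    show "inj_on A {..<t * N}"
      unfolding A_def N_def
      using k t
      by (intro inj_on_orbit_sequence[OF ident P1 orbits(1) _ cop(1) prim l_coprime[unfolded N_def]])
        simp_all
    show "inj_on B {..<t * N}"
      unfolding B_def N_def
      using k t
      by (intro inj_on_orbit_sequence[OF ident P2 orbits(2) _ cop(2) prim l_coprime[unfolded N_def]])
        simp_all
  qed
  moreover have "A (t * N) = A 0"
  proof -
    \<comment> \<open>After \<open>N\<close> rounds the accumulated exponent is a multiple of
      \<open>N\<close>, so the walk is back at \<open>X 1\<close>.\<close>
    have "field_mult \<phi> (\<alpha> powi (l * int N)) (X 1) = X 1"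
      using field_mult_power_int_stabilizer[OF ident P1[of 1] _ cop(1) prim] k t
      unfolding N_def by auto
    then show ?thesis
      using t by (simp add: A_def B_def field_mult_1[OF ident])
  qed
  \<comment> \<open>This excludes traversing a single edge back and forth. For \<open>t = 1\<close>
    it rests on \<open>N\<close> being at least 2, which holds because the dimension exceeds
    1.\<close>
  moreover have "t * N \<ge> 2"
  proof -
    have q1: "CARD('f) > 1"
      using card_mono[of UNIV "{0, 1::'f}"] by simp
    have "CARD('f) ^ 1 < CARD('f) ^ CARD('n)"
      using q1 k by (intro power_strict_increasing) (simp_all add: n)
    then have "1 * (CARD('f) - 1) < CARD('f) ^ CARD('n) - 1"
      using q1 by (simp add: diff_less_mono)
    also have "\<dots> = N * (CARD('f) - 1)"
      unfolding N_def by (rule dvd_div_mult_self[symmetric, OF minus_1_dvd_power_minus_1])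
    finally have "2 \<le> N"
      using q1 by (auto simp only: mult_less_cancel2)
    then show ?thesis
      using t by (metis mult_le_mono mult_1)
  qed
  ultimately have "has_cycle_of_length (middle_levels_graph k ::
      (('f ^ 'n) set, ('f ^ 'n) set \<times> ('f ^ 'n) set) pre_digraph) (2 * (t * N))"
    by (rule middle_levels_cycle)
  then show ?thesis
    unfolding N by (simp only: mult.assoc)
qed

end
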